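(* Let $G$ be a connected regular graph of order $n\ge 5$, and let $C(G)$ be its central graph. Then: (1) If $n$ is even and $G\not\cong K_n$, then $C(G)$ is an AVD-Type 2 graph, i.e. $\chi''_a(C(G))=\Delta(C(G))+2$. (2) If $n$ is odd, then $C(G)$ satisfies the AVD-TCC, i.e. $\chi''_a(C(G))\le\Delta(C(G))+3$.
   Context: All graphs are finite, undirected and simple. $\Delta(G)$ is the maximum degree of $G$, the order of a graph is its number of vertices, and $K_n$ is the complete graph on $n$ vertices. A proper total coloring of $G$ is a coloring of $V(G)\cup E(G)$ in which no two adjacent or incident elements receive the same color. An adjacent vertex distinguishing (AVD) total coloring of $G$ is a proper total coloring $f$ such that $C_G(u)\ne C_G(v)$ for every edge $uv\in E(G)$, where $C_G(u)=\{f(u)\}\cup\{f(uw): uw\in E(G)\}$. The AVD-total chromatic number $\chi''_a(G)$ is the least number of colors in an AVD-total coloring of $G$. A graph $G$ is of AVD-Type $i$ ($i\in\{1,2,3\}$) if $\chi''_a(G)=\Delta(G)+i$. The central graph $C(G)$ is obtained from $G$ by subdividing each edge exactly once (each edge $xy\in E(G)$ is replaced by the two edges $xw_{xy}$ and $w_{xy}y$, where $w_{xy}$ is a new vertex) and then adding all edges of the complement $\overline{G}$, i.e. joining every pair of distinct vertices of $G$ that are non-adjacent in $G$. *)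

theory Defs
  imports "Graph_Theory.Graph_Theory"
begin

text \<open>
  Finite simple undirected graphs are rendered by the locale \<open>pair_graph\<close>: a finite vertex set
  \<open>pverts G\<close> with a symmetric irreflexive adjacency relation \<open>parcs G\<close>. An undirected edge is thus
  a pair of opposite arcs; whenever edges themselves are coloured or subdivided, it is represented
  by the two-element set of its end points.
\<close>

definition uedges :: "'a pair_pre_digraph \<Rightarrow> 'a set set" where
  "uedges G = {{u, v} | u v. (u, v) \<in> parcs G}"

text \<open>By symmetry of the arcs, the degree of a vertex is its out-degree.\<close>

definition max_degree :: "'a pair_pre_digraph \<Rightarrow> nat" where
  "max_degree G = Max (out_degree (with_proj G) ` pverts G)"

definition regular_graph :: "'a pair_pre_digraph \<Rightarrow> bool" where
  "regular_graph G \<longleftrightarrow> (\<exists>k. \<forall>v \<in> pverts G. out_degree (with_proj G) v = k)"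

text \<open>
  The colored elements \<open>V(G) \<union> E(G)\<close> form the disjoint sum \<open>pverts G <+> uedges G\<close>: vertices are
  tagged \<open>Inl\<close>, edges \<open>Inr\<close>. Colors are natural numbers.
\<close>

definition proper_total_coloring :: "'a pair_pre_digraph \<Rightarrow> ('a + 'a set \<Rightarrow> nat) \<Rightarrow> bool" where
  "proper_total_coloring G f \<longleftrightarrow>
     (\<forall>u v. (u, v) \<in> parcs G \<longrightarrow> f (Inl u) \<noteq> f (Inl v)) \<and>
     (\<forall>e \<in> uedges G. \<forall>e' \<in> uedges G. e \<noteq> e' \<and> e \<inter> e' \<noteq> {} \<longrightarrow> f (Inr e) \<noteq> f (Inr e')) \<and>
     (\<forall>e \<in> uedges G. \<forall>u \<in> e. f (Inl u) \<noteq> f (Inr e))"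

definition color_set :: "'a pair_pre_digraph \<Rightarrow> ('a + 'a set \<Rightarrow> nat) \<Rightarrow> 'a \<Rightarrow> nat set" where
  "color_set G f u = {f (Inl u)} \<union> {f (Inr {u, w}) | w. (u, w) \<in> parcs G}"

definition avd_total_coloring :: "'a pair_pre_digraph \<Rightarrow> ('a + 'a set \<Rightarrow> nat) \<Rightarrow> bool" where
  "avd_total_coloring G f \<longleftrightarrow>
     proper_total_coloring G f \<and>
     (\<forall>u v. (u, v) \<in> parcs G \<longrightarrow> color_set G f u \<noteq> color_set G f v)"

definition avd_total_chromatic_number :: "'a pair_pre_digraph \<Rightarrow> nat" where
  "avd_total_chromatic_number G =
     (LEAST k. \<exists>f. avd_total_coloring G f \<and> card (f ` (pverts G <+> uedges G)) = k)"

definition avd_type :: "nat \<Rightarrow> 'a pair_pre_digraph \<Rightarrow> bool" where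
  "avd_type i G \<longleftrightarrow> i \<in> {1, 2, 3} \<and> avd_total_chromatic_number G = max_degree G + i"

definition satisfies_avd_tcc :: "'a pair_pre_digraph \<Rightarrow> bool" where
  "satisfies_avd_tcc G \<longleftrightarrow> avd_total_chromatic_number G \<le> max_degree G + 3"

text \<open>
  In the central graph, \<open>Inl v\<close> is the original vertex \<open>v\<close> and \<open>Inr {x, y}\<close> is the new vertex
  subdividing the edge \<open>xy\<close>.
\<close>

definition central_graph :: "'a pair_pre_digraph \<Rightarrow> ('a + 'a set) pair_pre_digraph" where
  "central_graph G =
     \<lparr> pverts = pverts G <+> uedges G,
       parcs = {(Inl u, Inr e) | u e. e \<in> uedges G \<and> u \<in> e}
             \<union> {(Inr e, Inl u) | u e. e \<in> uedges G \<and> u \<in> e}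
             \<union> {(Inl u, Inl v) | u v. u \<in> pverts G \<and> v \<in> pverts G \<and> u \<noteq> v \<and> (u, v) \<notin> parcs G} \<rparr>"

lemma finite_uedges: "pair_graph G \<Longrightarrow> finite (uedges G)"
proof -
  assume "pair_graph G"
  then interpret pair_graph G .
  have "uedges G = (\<lambda>(u, v). {u, v}) ` parcs G"
    by (auto simp: uedges_def image_iff)
  then show ?thesis using pair_finite_arcs by simp
qed

lemma pair_graph_central_graph:
  assumes "pair_graph G"
  shows "pair_graph (central_graph G)"
proof -
  interpret pair_graph G by (rule assms)
  have sub: "e \<subseteq> pverts G" if "e \<in> uedges G" for e
    using that by (auto simp: uedges_def dest: in_arcsD1 in_arcsD2)
  have symG: "(v, u) \<in> parcs G" if "(u, v) \<in> parcs G" for u v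
    using pair_sym_arcs that by (auto simp: symmetric_def dest: symD)
  have fV: "finite (pverts (central_graph G))"
    using finite_uedges[OF assms] pair_finite_verts by (simp add: central_graph_def)
  have wf: "parcs (central_graph G) \<subseteq> pverts (central_graph G) \<times> pverts (central_graph G)"
    using sub by (auto simp: central_graph_def)
  have fE: "finite (parcs (central_graph G))"
    by (rule finite_subset[OF wf]) (simp add: fV)
  have irr: "fst a \<noteq> snd a" if "a \<in> parcs (central_graph G)" for a
    using that unfolding central_graph_def by fastforce
  have sym: "sym (parcs (central_graph G))"
    unfolding sym_def central_graph_def using symG by fastforce
  show ?thesis
  proof
    show "symmetric (with_proj (central_graph G))"
      unfolding symmetric_def with_proj_simps by (rule sym)
    show "fst a \<in> pverts (central_graph G)" "snd a \<in> pverts (central_graph G)"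
      if "a \<in> parcs (central_graph G)" for a
      using subsetD[OF wf that] by (simp_all add: mem_Times_iff)
  qed (use irr fV fE in blast)+
qed

text \<open>Hence the minimum in \<open>avd_total_chromatic_number\<close> is attained.\<close>

lemma avd_total_coloring_exists:
  assumes "pair_graph G"
  shows "\<exists>f. avd_total_coloring G f"
proof -
  interpret pair_graph G by (rule assms)
  let ?S = "pverts G <+> uedges G"
  have "finite ?S" using finite_uedges[OF assms] pair_finite_verts by simp
  then have "\<exists>f :: 'a + 'a set \<Rightarrow> nat. inj_on f ?S"
    using finite_imp_inj_to_nat_seg[of ?S] by metis
  then obtain f :: "'a + 'a set \<Rightarrow> nat" where f: "inj_on f ?S" ..
  have inj: "f x \<noteq> f y" if "x \<in> ?S" "y \<in> ?S" "x \<noteq> y" for x y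
    using inj_onD[OF f _ that(1,2)] that(3) by blast
  have V: "u \<in> pverts G" "v \<in> pverts G" "u \<noteq> v" "{u, v} \<in> uedges G" if "(u, v) \<in> parcs G" for u v
    using in_arcsD1[OF that] in_arcsD2[OF that] pair_no_loops[OF that] that
    unfolding uedges_def by simp_all blast
  have sub: "u \<in> pverts G" if "e \<in> uedges G" "u \<in> e" for e u
    using that V(1,2) unfolding uedges_def by blast
  have "proper_total_coloring G f"
    unfolding proper_total_coloring_def
  proof (intro conjI allI ballI impI)
    show "f (Inl u) \<noteq> f (Inl v)" if "(u, v) \<in> parcs G" for u v
      by (rule inj) (use V[OF that] in \<open>simp_all add: InlI InrI\<close>)
    show "f (Inr e) \<noteq> f (Inr e')"
      if "e \<in> uedges G" "e' \<in> uedges G" "e \<noteq> e' \<and> e \<inter> e' \<noteq> {}" for e e'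
      by (rule inj) (use that in \<open>simp_all add: InlI InrI\<close>)
    show "f (Inl u) \<noteq> f (Inr e)" if "e \<in> uedges G" "u \<in> e" for e u
      by (rule inj) (use that sub in \<open>simp_all add: InlI InrI\<close>)
  qed
  moreover have "color_set G f u \<noteq> color_set G f v" if uv: "(u, v) \<in> parcs G" for u v
  proof -
    have "f (Inl u) \<noteq> f (Inl v)"
      by (rule inj) (use V[OF uv] in \<open>simp_all add: InlI InrI\<close>)
    moreover have "f (Inl u) \<noteq> f (Inr {v, w})" if "(v, w) \<in> parcs G" for w
      by (rule inj) (use V(1)[OF uv] V(4)[OF that] in \<open>simp_all add: InlI InrI\<close>)
    ultimately have "f (Inl u) \<notin> color_set G f v"
      unfolding color_set_def by blast
    moreover have "f (Inl u) \<in> color_set G f u"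
      unfolding color_set_def by blast
    ultimately show ?thesis by metis
  qed
  ultimately show ?thesis unfolding avd_total_coloring_def by blast
qed

end

theory Submission
  imports Defs "HOL-Number_Theory.Cong"
begin

text \<open>
  Every original vertex has degree \<open>n - 1\<close> in \<open>C(G)\<close>. If \<open>G\<close> is not complete, two original vertices
  are adjacent in \<open>C(G)\<close>; with only \<open>n\<close> colors both would see all of them, so \<open>n + 1\<close> colors are
  needed.

  Conversely, let \<open>M > n\<close> be odd. Label the vertices by \<open>l\<close> with \<open>0, \<dots>, n - 1\<close>, a root \<open>r\<close> getting \<open>0\<close>
  and its neighbours in \<open>G\<close> the largest labels. Color the vertex \<open>u\<close> by \<open>2 l(u)\<close> and the pair \<open>uv\<close> by
  \<open>l(u) + l(v)\<close>, both modulo \<open>M\<close>: colors of distinct vertices differ, and the color sets are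
  distinct cyclic intervals. The only conflict is that the two halves of a subdivided edge have the
  same color. To repair it, permute at each vertex \<open>u\<close> the colors of the half-edges towards the
  \<open>G\<close>-neighbours of \<open>u\<close>, which leaves the color set of \<open>u\<close> unchanged. Treating the vertices in order
  of decreasing distance from \<open>r\<close>, each \<open>u \<noteq> r\<close> has a neighbour that is still untreated, and this
  suffices to find a good permutation. At \<open>r\<close> one can only fail if all neighbours forbid the same
  color \<open>c\<close>; then \<open>c\<close> is replaced at \<open>r\<close> by the color \<open>M - 1\<close>. As \<open>c\<close> is the label of a neighbour of
  \<open>r\<close>, it is seen by all vertices not adjacent to \<open>r\<close> in \<open>G\<close>, so the color set of \<open>r\<close> still differs
  from theirs.
\<close>

section \<open>Permuting colors subject to forbidden values\<close>

text \<open>By induction on the size of \<open>N\<close>. If some forbidden value lies in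
  \<open>S\<close>, it is assigned to an element that forbids a different one, and the rest is left
  to the induction; otherwise any bijection will do.\<close>

lemma bij_betw_avoiding:
  assumes "finite N" "finite S" "card N = card S"
    and "\<not> (\<exists>c \<in> S. \<forall>v \<in> N. h v = c)"
  shows "\<exists>g. bij_betw g N S \<and> (\<forall>v \<in> N. g v \<noteq> h v)"
  using assms
proof (induction "card N" arbitrary: N S)
  case 0
  then show ?case by (auto simp: bij_betw_def)
next
  case (Suc k)
  show ?case
  proof (cases "\<exists>v1 \<in> N. h v1 \<in> S")
    case True
    then obtain v1 where v1: "v1 \<in> N" "h v1 \<in> S" by blast
    let ?c = "h v1"
    \<comment> \<open>Using up \<open>h v1\<close> on another element makes the hypothesis on \<open>h\<close> hold for what is left.\<close>
    from Suc.prems(4) v1(2) obtain v where v: "v \<in> N" "h v \<noteq> ?c" by blast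
    have "\<exists>g. bij_betw g (N - {v}) (S - {?c}) \<and> (\<forall>w \<in> N - {v}. g w \<noteq> h w)"
    proof (rule Suc.hyps(1))
      show "k = card (N - {v})" using Suc.hyps(2) Suc.prems(1) v(1) by simp
      show "card (N - {v}) = card (S - {?c})" using Suc.prems v(1) v1(2) by simp
      have "v1 \<in> N - {v}" using v1 v by auto
      then show "\<not> (\<exists>c \<in> S - {?c}. \<forall>w \<in> N - {v}. h w = c)" by force
    qed (use Suc.prems in auto)
    then obtain g where g: "bij_betw g (N - {v}) (S - {?c})" "\<forall>w \<in> N - {v}. g w \<noteq> h w"
      by blast
    have "bij_betw (g(v := ?c)) (insert v (N - {v})) (insert ?c (S - {?c}))"
      using g(1) unfolding bij_betw_def by (auto simp: inj_on_def image_iff)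
    moreover have "insert v (N - {v}) = N" "insert ?c (S - {?c}) = S" using v v1 by auto
    ultimately have "bij_betw (g(v := ?c)) N S" by simp
    moreover have "\<forall>w \<in> N. (g(v := ?c)) w \<noteq> h w" using g(2) v by auto
    ultimately show ?thesis by blast
  next
    case False
    obtain g where "bij_betw g N S" using finite_same_card_bij Suc.prems by metis
    with False show ?thesis by (metis bij_betwE)
  qed
qed

text \<open>The vertices of \<open>P\<close> are treated by decreasing rank. When \<open>u\<close>
  is reached, its neighbour of smaller rank is still untreated and imposes no constraint, so the
  neighbours of \<open>u\<close> cannot all forbid the same color of \<open>S u\<close>.\<close>

lemma half_edge_coloring_of_ranked:
  fixes E :: "'a rel" and S :: "'a \<Rightarrow> nat set" and rank :: "'a \<Rightarrow> nat"
  assumes "irrefl E" "sym E"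
    and "\<And>u. finite (E `` {u})" "\<And>u. finite (S u)" "\<And>u. card (E `` {u}) = card (S u)"
    and "finite P" "\<forall>u \<in> P. \<exists>w. (u, w) \<in> E \<and> rank w < rank u"
  shows "\<exists>g. (\<forall>u \<in> P. bij_betw (g u) (E `` {u}) (S u)) \<and>
             (\<forall>u \<in> P. \<forall>v \<in> P. (u, v) \<in> E \<longrightarrow> g u v \<noteq> g v u)"
  using assms(6,7)
\<comment> \<open>The induction rule inserts elements in increasing order of \<open>f\<close>;
  negating the rank turns this into decreasing rank.\<close>
proof (induction P rule: finite_ranking_induct[where f = "\<lambda>u. - int (rank u)"])
  case empty
  then show ?case by simp
next
  case (insert u P)
  then obtain g where g: "\<forall>v \<in> P. bij_betw (g v) (E `` {v}) (S v)"
      "\<forall>v \<in> P. \<forall>w \<in> P. (v, w) \<in> E \<longrightarrow> g v w \<noteq> g w v"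
    by auto
  obtain w where w: "(u, w) \<in> E" "rank w < rank u" using insert.prems by blast
  then have "w \<notin> P" using insert.hyps(2) by fastforce
  \<comment> \<open>A dummy outside \<open>S u\<close>: forbidding \<open>x\<close> towards
    untreated neighbours costs nothing, and at \<open>w\<close> it keeps \<open>?h\<close> from
    being constant with a value in \<open>S u\<close>.\<close>
  obtain x where x: "x \<notin> S u" using ex_new_if_finite[OF infinite_UNIV_nat assms(4)] by blast
  let ?h = "\<lambda>v. if v \<in> P then g v u else x"
  have "\<not> (\<exists>c \<in> S u. \<forall>v \<in> E `` {u}. ?h v = c)" using x w(1) \<open>w \<notin> P\<close> by auto
  from bij_betw_avoiding[OF assms(3,4,5) this]
  obtain k where k: "bij_betw k (E `` {u}) (S u)" "\<forall>v \<in> E `` {u}. k v \<noteq> ?h v" by blast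
  have "(u, u) \<notin> E" using assms(1) by (simp add: irrefl_def)
  moreover have "k v \<noteq> g v u" if "v \<in> P" "(u, v) \<in> E \<or> (v, u) \<in> E" for v
    using bspec[OF k(2), of v] that assms(2) by (auto dest: symD)
  ultimately have "(g(u := k)) v w \<noteq> (g(u := k)) w v"
    if "v \<in> insert u P" "w \<in> insert u P" "(v, w) \<in> E" for v w
    using g(2) that by (cases "v = u"; cases "w = u") (auto dest: not_sym)
  with g(1) k(1) show ?case by (intro exI[of _ "g(u := k)"]) simp
qed

text \<open>Ranking by distance to \<open>r\<close> settles all vertices except \<open>r\<close>,
  which has no neighbour of smaller rank. There the exceptional case is resolved by trading the
  color forbidden by all neighbours for the spare color \<open>x\<close>.\<close>

lemma half_edge_coloring:
  fixes E :: "'a rel" and S :: "'a \<Rightarrow> nat set"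
  assumes "irrefl E" "sym E"
    and "\<And>u. finite (E `` {u})" "\<And>u. finite (S u)" "\<And>u. card (E `` {u}) = card (S u)"
    and "finite V" "E \<subseteq> V \<times> V" "\<forall>v \<in> V. (v, r) \<in> E\<^sup>*" "x \<notin> S r"
  shows "\<exists>g. (\<forall>(u, v) \<in> E. g u v \<noteq> g v u) \<and>
             (\<forall>u \<in> V - {r}. bij_betw (g u) (E `` {u}) (S u)) \<and>
             (bij_betw (g r) (E `` {r}) (S r) \<or>
              (\<exists>c \<in> S r. bij_betw (g r) (E `` {r}) (insert x (S r - {c}))))"
proof -
  \<comment> \<open>Distance to \<open>r\<close>; the first step of a shortest walk lowers it by
    one.\<close>
  define rank where "rank v = (LEAST k. (v, r) \<in> E ^^ k)" for v
  have "\<exists>w. (u, w) \<in> E \<and> rank w < rank u" if u: "u \<in> V - {r}" for u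
  proof -
    have "\<exists>k. (u, r) \<in> E ^^ k" using assms(8) u by (auto simp: rtrancl_power)
    then have *: "(u, r) \<in> E ^^ rank u" unfolding rank_def by (rule LeastI_ex)
    with u obtain k where k: "rank u = Suc k" by (cases "rank u") auto
    with * obtain w where w: "(u, w) \<in> E" "(w, r) \<in> E ^^ k" by (metis relpow_Suc_D2)
    then have "rank w \<le> k" unfolding rank_def by (intro Least_le)
    with w k show ?thesis by auto
  qed
  with half_edge_coloring_of_ranked[OF assms(1,2,3,4,5), of "V - {r}" rank] assms(6)
  obtain g where g: "\<forall>u \<in> V - {r}. bij_betw (g u) (E `` {u}) (S u)"
      "\<forall>u \<in> V - {r}. \<forall>v \<in> V - {r}. (u, v) \<in> E \<longrightarrow> g u v \<noteq> g v u"
    by auto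
  have "\<exists>k. (\<forall>v \<in> E `` {r}. k v \<noteq> g v r) \<and>
    (bij_betw k (E `` {r}) (S r) \<or> (\<exists>c \<in> S r. bij_betw k (E `` {r}) (insert x (S r - {c}))))"
  proof (cases "\<exists>c \<in> S r. \<forall>v \<in> E `` {r}. g v r = c")
    case True
    then obtain c where c: "c \<in> S r" "\<forall>v \<in> E `` {r}. g v r = c" by blast
    \<comment> \<open>Every neighbour forbids only \<open>c\<close>, so once \<open>c\<close> is
      replaced by \<open>x\<close> an arbitrary bijection is good.\<close>
    have "card (E `` {r}) = card (insert x (S r - {c}))"
      using c(1) assms(4)[of r] assms(5)[of r] assms(9) by (simp add: card_Suc_Diff1 del: card_Diff_insert)
    then obtain k where k: "bij_betw k (E `` {r}) (insert x (S r - {c}))"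
      using finite_same_card_bij assms(3,4) by (metis finite_Diff finite_insert)
    have "k v \<noteq> g v r" if "v \<in> E `` {r}" for v
    proof -
      have "k v \<in> insert x (S r - {c})" using k that by (meson bij_betwE)
      then show ?thesis using c that assms(9) by auto
    qed
    with k c(1) show ?thesis by blast
  next
    case False
    from bij_betw_avoiding[OF assms(3,4,5) False] show ?thesis by blast
  qed
  then obtain k where k: "\<forall>v \<in> E `` {r}. k v \<noteq> g v r"
    "bij_betw k (E `` {r}) (S r) \<or> (\<exists>c \<in> S r. bij_betw k (E `` {r}) (insert x (S r - {c})))"
    by blast
  let ?g = "g(r := k)"
  have "?g u v \<noteq> ?g v u" if uv: "(u, v) \<in> E" for u v
  proof -
    have "u \<noteq> v" using uv assms(1) by (auto simp: irrefl_def)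
    moreover have "u \<in> V" "v \<in> V" "(v, u) \<in> E" using uv assms(2,7) by (auto dest: symD)
    ultimately show ?thesis using g(2) k(1) uv by (cases "u = r"; cases "v = r") (auto dest: not_sym)
  qed
  then have "\<forall>(u, v) \<in> E. ?g u v \<noteq> ?g v u" by blast
  with g(1) k(2) show ?thesis by (intro exI[of _ ?g]) simp
qed

section \<open>The cyclic color scheme\<close>

text \<open>The label 0 makes the color of a pair at \<open>r\<close> equal to the label of the
  other vertex. With the neighbours last, a color lost at \<open>r\<close> is a label above those of
  all vertices not adjacent to \<open>r\<close>, which is why they still see it.\<close>

lemma ex_labelling_neighbours_last:
  assumes "finite V" "r \<in> V" "N \<subseteq> V - {r}"
  shows "\<exists>l. bij_betw l V {..<card V} \<and> l r = 0 \<and> (\<forall>w \<in> N. \<forall>v \<in> V - N. l v < l w)"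
proof -
  define A where "A = V - N - {r}"
  have fin: "finite A" "finite N" using assms by (auto simp: A_def intro: finite_subset)
  have "V = insert r (A \<union> N)" "r \<notin> A \<union> N" "A \<inter> N = {}" using assms by (auto simp: A_def)
  then have cV: "card V = Suc (card A + card N)" using fin by (simp add: card_Un_disjoint)
  have "\<exists>a. bij_betw a A {1..<Suc (card A)}" "\<exists>b. bij_betw b N {Suc (card A)..<card V}"
    by (rule finite_same_card_bij; simp add: fin cV)+
  then obtain a b where a: "bij_betw a A {1..<Suc (card A)}"
    and b: "bij_betw b N {Suc (card A)..<card V}"
    by blast
  define l where "l v = (if v = r then 0 else if v \<in> N then b v else a v)" for v
  have "bij_betw l {r} {0}" by (simp add: l_def bij_betw_def)
  moreover have la: "bij_betw l A {1..<Suc (card A)}"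
    by (subst bij_betw_cong[where g = a]) (use a in \<open>auto simp: l_def A_def\<close>)
  moreover have lb: "bij_betw l N {Suc (card A)..<card V}"
    by (subst bij_betw_cong[where g = b]) (use b assms in \<open>auto simp: l_def\<close>)
  ultimately have "bij_betw l ({r} \<union> A \<union> N) ({0} \<union> {1..<Suc (card A)} \<union> {Suc (card A)..<card V})"
    by (intro bij_betw_combine) auto
  moreover have "{r} \<union> A \<union> N = V" using assms by (auto simp: A_def)
  moreover have "{0} \<union> {1..<Suc (card A)} \<union> {Suc (card A)..<card V} = {..<card V}"
    using cV by auto
  ultimately have "bij_betw l V {..<card V}" by simp
  moreover have "l v < l w" if "w \<in> N" "v \<in> V - N" for v w
  proof -
    have "l w \<ge> Suc (card A)" using bij_betwE[OF lb] that by auto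
    moreover have "l v < Suc (card A)"
      using bij_betwE[OF la] that(2) by (cases "v = r") (auto simp: l_def A_def)
    ultimately show ?thesis by simp
  qed
  ultimately show ?thesis by (intro exI[of _ l]) (auto simp: l_def)
qed

text \<open>
  Here \<open>k u u\<close> is the color of the vertex \<open>u\<close>, and \<open>k u v\<close> that of the edge of \<open>C(G)\<close> leaving \<open>u\<close> in the
  direction of \<open>v\<close>, which ends either in \<open>v\<close> or in the vertex subdividing \<open>uv\<close>.
\<close>

lemma ex_half_edge_scheme:
  fixes G :: "'a pair_pre_digraph"
  assumes "pair_graph G" "Digraph_Component.connected (with_proj G)"
    and "odd M" "card (pverts G) < M"
  obtains k :: "'a \<Rightarrow> 'a \<Rightarrow> nat" where
    "\<And>u v. u \<in> pverts G \<Longrightarrow> v \<in> pverts G \<Longrightarrow> k u v < M"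
    "\<And>u. u \<in> pverts G \<Longrightarrow> inj_on (k u) (pverts G)"
    "\<And>u v. (u, v) \<in> parcs G \<Longrightarrow> k u v \<noteq> k v u"
    "\<And>u v. u \<in> pverts G \<Longrightarrow> v \<in> pverts G \<Longrightarrow> u \<noteq> v \<Longrightarrow> (u, v) \<notin> parcs G \<Longrightarrow>
       k u v = k v u \<and> k u u \<noteq> k v v \<and> k u ` pverts G \<noteq> k v ` pverts G"
proof -
  interpret pair_graph G by (rule assms)
  let ?V = "pverts G" and ?E = "parcs G" and ?n = "card (pverts G)"
  let ?N = "\<lambda>u. parcs G `` {u}"
  have finV: "finite ?V" by (rule pair_finite_verts)
  have EV: "?E \<subseteq> ?V \<times> ?V" using in_arcsD1 in_arcsD2 by auto
  have symE: "sym ?E" using pair_sym_arcs by (simp add: symmetric_def)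
  have irreflE: "irrefl ?E" using pair_no_loops by (force simp: irrefl_def)
  have NV: "?N u \<subseteq> ?V - {u}" for u using EV irreflE by (auto simp: irrefl_def)
  have finN: "finite (?N u)" for u using NV finV by (meson finite_Diff finite_subset)
  \<comment> \<open>\<open>connected\<close> means strong connectivity of the symmetric closure, and
    \<open>G\<close> is its own symmetric closure.\<close>
  have "mk_symmetric (with_proj G) = G"
    by (rule pair_pre_digraph.equality) (simp_all add: adj_mk_symmetric_eq pair_sym_arcs)
  then have conn: "strongly_connected (with_proj G)"
    using assms(2) unfolding connected_def by simp
  then obtain r where r: "r \<in> ?V" by (auto simp: strongly_connected_def)
  have reach: "\<forall>v \<in> ?V. (v, r) \<in> ?E\<^sup>*"
  proof
    fix v assume "v \<in> ?V"
    then have "v \<rightarrow>\<^sup>*\<^bsub>with_proj G\<^esub> r" using conn r by (simp add: strongly_connected_def)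
    then show "(v, r) \<in> ?E\<^sup>*" using reachable_conv by simp
  qed
  obtain l where l: "bij_betw l ?V {..<?n}" "l r = 0"
    and l_less: "\<And>v w. w \<in> ?N r \<Longrightarrow> v \<in> ?V - ?N r \<Longrightarrow> l v < l w"
    using ex_labelling_neighbours_last[OF finV r NV] by blast
  have ln: "l v < ?n" if "v \<in> ?V" for v using bij_betwE[OF l(1)] that by auto
  have l_eq: "l u = l v \<longleftrightarrow> u = v" if "u \<in> ?V" "v \<in> ?V" for u v
    using l(1) that by (auto simp: bij_betw_def inj_on_def)
  have l_surj: "\<exists>v \<in> ?V. l v = i" if "i < ?n" for i
    using l(1) that unfolding bij_betw_def by (metis imageE lessThan_iff)
  define c where "c u v = (l u + l v) mod M" for u v
  have c_lt: "c u v < M" for u v using assms(4) by (simp add: c_def)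
  have c_commute: "c u v = c v u" for u v by (simp add: c_def add.commute)
  have c_inj: "inj_on (c u) ?V" for u
  proof (rule inj_onI)
    fix v w assume vw: "v \<in> ?V" "w \<in> ?V" "c u v = c u w"
    then have "[l v = l w] (mod M)" unfolding c_def by (metis cong_add_lcancel_nat cong_def)
    then have "l v = l w" using ln[OF vw(1)] ln[OF vw(2)] assms(4) by (simp add: cong_def)
    then show "v = w" using l_eq vw by simp
  qed
  have c_diag: "c u u \<noteq> c v v" if "u \<in> ?V" "v \<in> ?V" "u \<noteq> v" for u v
  proof
    assume "c u u = c v v"
    then have "[2 * l u = 2 * l v] (mod M)" by (simp add: c_def cong_def mult_2)
    \<comment> \<open>As \<open>M\<close> is odd, 2 can be cancelled.\<close>
    then have "[l u = l v] (mod M)" using assms(3) by (simp add: cong_mult_lcancel_nat coprime_commute)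
    then have "l u = l v" using ln[OF that(1)] ln[OF that(2)] assms(4) by (simp add: cong_def)
    then show False using l_eq that by simp
  qed
  \<comment> \<open>The separating color is \<open>l v - 1\<close>. It directly precedes the
    interval of \<open>v\<close>, which is too short to wrap around to it because
    \<open>?n < M\<close>; the interval of \<open>u\<close> starts no later than
    \<open>l v - 1\<close> and reaches it.\<close>
  have c_image_ne: "c u ` ?V \<noteq> c v ` ?V" if uv: "u \<in> ?V" "v \<in> ?V" "l u < l v" for u v
  proof -
    have "l v - 1 - l u < ?n" using ln[OF uv(2)] by linarith
    then obtain w where w: "w \<in> ?V" "l w = l v - 1 - l u" using l_surj by blast
    then have "c u w = l v - 1" using uv(3) ln[OF uv(2)] assms(4) by (simp add: c_def)
    moreover have "c v w' \<noteq> l v - 1" if "w' \<in> ?V" for w'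
    proof (cases "l v + l w' < M")
      case True
      then show ?thesis using \<open>l u < l v\<close> by (simp add: c_def)
    next
      case False
      then have "c v w' = l v + l w' - M"
        using ln[OF \<open>v \<in> ?V\<close>] ln[OF that] assms(4) by (simp add: c_def mod_if)
      then show ?thesis using False \<open>l u < l v\<close> ln[OF that] assms(4) by simp
    qed
    ultimately show ?thesis using w(1) by (metis imageE imageI)
  qed
  define S where "S u = c u ` ?N u" for u
  have cr: "c r v = l v" if "v \<in> ?V" for v using ln[OF that] assms(4) l(2) by (simp add: c_def)
  \<comment> \<open>The row of \<open>r\<close> is \<open>{..<?n}\<close>, and
    \<open>?n \<le> M - 1\<close>, so \<open>M - 1\<close> is the spare color at
    \<open>r\<close>.\<close>
  have cM: "c r v \<noteq> M - 1" if "v \<in> ?V" for v using ln[OF that] assms(4) cr[OF that] by simp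
  then have cM_image: "M - 1 \<notin> c r ` ?V" by (metis imageE)
  have "card (?N u) = card (S u)" for u
    unfolding S_def using c_inj NV by (metis card_image Diff_subset inj_on_subset order_trans)
  moreover have "M - 1 \<notin> S r" unfolding S_def using cM NV by force
  ultimately obtain g where g: "\<forall>(u, v) \<in> ?E. g u v \<noteq> g v u"
    "\<forall>u \<in> ?V - {r}. bij_betw (g u) (?N u) (S u)"
    "bij_betw (g r) (?N r) (S r) \<or>
       (\<exists>a \<in> S r. bij_betw (g r) (?N r) (insert (M - 1) (S r - {a})))"
    using half_edge_coloring[of ?E S ?V r "M - 1"] irreflE symE finN finV EV reach
    by (auto simp: S_def)
  \<comment> \<open>Only half-edges towards \<open>G\<close>-neighbours are recolored; the vertex
    colors and the edges between original vertices keep the symmetric coloring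
    \<open>c\<close>.\<close>
  define k where "k u v = (if (u, v) \<in> ?E then g u v else c u v)" for u v
  have k_image: "k u ` ?V = g u ` ?N u \<union> c u ` (?V - ?N u)" for u
    using NV[of u] by (auto simp: k_def image_iff)
  have k_inj: "inj_on (k u) ?V" if "inj_on (g u) (?N u)" "g u ` ?N u \<inter> c u ` (?V - ?N u) = {}" for u
  proof -
    have "inj_on (k u) (?N u)" using that(1) by (auto simp: k_def inj_on_def)
    moreover have "inj_on (k u) (?V - ?N u)" using c_inj[of u] by (auto simp: k_def inj_on_def)
    moreover have "k u ` ?N u \<inter> k u ` (?V - ?N u) = {}" using that(2) by (auto simp: k_def)
    ultimately have "inj_on (k u) (?N u \<union> (?V - ?N u))" by (subst inj_on_Un) auto
    moreover have "?N u \<union> (?V - ?N u) = ?V" using NV by auto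
    ultimately show ?thesis by simp
  qed
  have S_disj: "S u \<inter> c u ` (?V - ?N u) = {}" for u
    unfolding S_def using c_inj[of u] NV[of u] by (subst inj_on_image_Int[symmetric, of _ ?V]) auto
  have unswapped: "inj_on (k u) ?V \<and> k u ` ?V = c u ` ?V" if "bij_betw (g u) (?N u) (S u)" for u
  proof -
    have "g u ` ?N u = S u" "inj_on (g u) (?N u)" using that by (auto simp: bij_betw_def)
    moreover have "S u \<union> c u ` (?V - ?N u) = c u ` ?V" using NV[of u] by (auto simp: S_def)
    ultimately show ?thesis using k_inj S_disj k_image by auto
  qed
  \<comment> \<open>If a color was traded at \<open>r\<close>, it is \<open>c r w = l w\<close> for
    a neighbour \<open>w\<close>. It then disappears from the row of \<open>r\<close>, since by
    injectivity of \<open>c r\<close> no other vertex supplies it.\<close>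
  have root: "inj_on (k r) ?V \<and> (\<forall>i \<in> k r ` ?V. i < M) \<and>
      (k r ` ?V = c r ` ?V \<or> (\<exists>w \<in> ?N r. l w \<notin> k r ` ?V))"
    using g(3)
  proof
    assume "bij_betw (g r) (?N r) (S r)"
    from unswapped[OF this] c_lt show ?thesis by auto
  next
    assume "\<exists>a \<in> S r. bij_betw (g r) (?N r) (insert (M - 1) (S r - {a}))"
    then obtain w where w: "w \<in> ?N r" "bij_betw (g r) (?N r) (insert (M - 1) (S r - {c r w}))"
      by (auto simp: S_def)
    have wV: "w \<in> ?V" using w(1) NV by auto
    have gr: "g r ` ?N r = insert (M - 1) (S r - {c r w})" "inj_on (g r) (?N r)"
      using w(2) by (auto simp: bij_betw_def)
    have "g r ` ?N r \<inter> c r ` (?V - ?N r) = {}" 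
      unfolding gr(1) using S_disj[of r] cM_image by blast
    then have "inj_on (k r) ?V" using k_inj gr(2) by blast
    moreover have "i < M" if "i \<in> k r ` ?V" for i
      using that c_lt assms(4) unfolding k_image gr by (auto simp: S_def)
    moreover have "c r w \<in> S r" using w(1) by (simp add: S_def)
    then have "c r w \<notin> k r ` ?V"
      using S_disj[of r] cM[OF wV] unfolding k_image gr by auto
    ultimately show ?thesis using cr[OF wV] w(1) by auto
  qed
  have all: "inj_on (k u) ?V \<and> (\<forall>i \<in> k u ` ?V. i < M)" if "u \<in> ?V" for u
    using root unswapped[of u] g(2) that c_lt by (cases "u = r") auto
  have ne_r: "k r ` ?V \<noteq> k v ` ?V" if "v \<in> ?V" "v \<noteq> r" "(r, v) \<notin> ?E" for v
  proof -
    have kv: "k v ` ?V = c v ` ?V" using unswapped g(2) that by auto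
    from root consider "k r ` ?V = c r ` ?V" | w where "w \<in> ?N r" "l w \<notin> k r ` ?V" by blast
    then show ?thesis
    proof cases
      case 1
      have "l v \<noteq> l r" using l_eq[OF that(1) r] that(2) by simp
      then show ?thesis using kv 1 c_image_ne[OF r that(1)] l(2) by simp
    next
      case 2
      \<comment> \<open>The color \<open>l w\<close> missing at \<open>r\<close> is present at
        \<open>v\<close>: it is \<open>l v + l y\<close> for the vertex \<open>y\<close> labelled
        \<open>l w - l v\<close>, with no reduction modulo \<open>M\<close>.\<close>
      have lvw: "l v < l w" using l_less 2(1) that by auto
      have lw: "l w < ?n" using 2(1) NV ln by blast
      have "l w - l v < ?n" using lw by linarith
      then obtain y where y: "y \<in> ?V" "l y = l w - l v" using l_surj by blast
      then have "c v y = l w" using lvw lw assms(4) by (simp add: c_def)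
      then have "l w \<in> k v ` ?V" using kv y(1) by (metis imageI)
      then show ?thesis using 2(2) by blast
    qed
  qed
  have ne: "k u ` ?V \<noteq> k v ` ?V" if "u \<in> ?V" "v \<in> ?V" "u \<noteq> v" "(u, v) \<notin> ?E" for u v
  proof -
    have "(v, u) \<notin> ?E" using that(4) symE by (auto dest: symD)
    consider "u = r" | "v = r" | "u \<noteq> r" "v \<noteq> r" by blast
    then show ?thesis
    proof cases
      case 1 then show ?thesis using ne_r that by metis
    next
      case 2 then show ?thesis using ne_r that \<open>(v, u) \<notin> ?E\<close> by metis
    next
      case 3
      then have "k u ` ?V = c u ` ?V" "k v ` ?V = c v ` ?V" using unswapped g(2) that by auto
      moreover have "l u < l v \<or> l v < l u" using l_eq that by (metis nat_neq_iff)
      ultimately show ?thesis using c_image_ne that by metis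
    qed
  qed
  show thesis
  proof (rule that[of k])
    show "k u v < M" if "u \<in> ?V" "v \<in> ?V" for u v using all that by auto
    show "inj_on (k u) ?V" if "u \<in> ?V" for u using all that by auto
    show "k u v \<noteq> k v u" if "(u, v) \<in> ?E" for u v
      using g(1) that symE by (auto simp: k_def dest: symD)
    show "k u v = k v u \<and> k u u \<noteq> k v v \<and> k u ` ?V \<noteq> k v ` ?V"
      if "u \<in> ?V" "v \<in> ?V" "u \<noteq> v" "(u, v) \<notin> ?E" for u v
    proof -
      have "(v, u) \<notin> ?E" "(u, u) \<notin> ?E" "(v, v) \<notin> ?E"
        using that(4) symE irreflE by (auto dest: symD simp: irrefl_def)
      then have "k u v = c u v" "k v u = c v u" "k u u = c u u" "k v v = c v v"
        using that(4) by (simp_all add: k_def)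
      then show ?thesis using ne[OF that] c_diag[OF that(1-3)] c_commute by simp
    qed
  qed
qed

section \<open>Color sets and the lower bound\<close>

text \<open>Distinct edges that meet share an end point, so their colors need only be compared along
  the neighbourhood of each vertex.\<close>

lemma proper_total_coloringI:
  assumes "pair_graph H"
    and vertices: "\<And>u v. (u, v) \<in> parcs H \<Longrightarrow> f (Inl u) \<noteq> f (Inl v)"
    and edges: "\<And>u. inj_on (\<lambda>v. f (Inr {u, v})) {v. (u, v) \<in> parcs H}"
    and incident: "\<And>u v. (u, v) \<in> parcs H \<Longrightarrow> f (Inl u) \<noteq> f (Inr {u, v})"
  shows "proper_total_coloring H f"
proof -
  interpret pair_graph H by (rule assms)
  have symH: "(v, u) \<in> parcs H" if "(u, v) \<in> parcs H" for u v
    using pair_sym_arcs that by (auto simp: symmetric_def dest: symD)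
  have edgeE: "\<exists>v. e = {u, v} \<and> (u, v) \<in> parcs H" if "e \<in> uedges H" "u \<in> e" for e u
    using that symH unfolding uedges_def by (auto simp: insert_commute)
  show ?thesis
    unfolding proper_total_coloring_def
  proof (intro conjI allI ballI impI)
    fix e e' assume e: "e \<in> uedges H" "e' \<in> uedges H" "e \<noteq> e' \<and> e \<inter> e' \<noteq> {}"
    then obtain u where "u \<in> e" "u \<in> e'" by blast
    with e obtain v v' where "e = {u, v}" "(u, v) \<in> parcs H" "e' = {u, v'}" "(u, v') \<in> parcs H"
      using edgeE by metis
    with e(3) show "f (Inr e) \<noteq> f (Inr e')" using inj_onD[OF edges, of u v v'] by auto
  next
    show "f (Inl u) \<noteq> f (Inr e)" if "e \<in> uedges H" "u \<in> e" for e u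
      using edgeE[OF that] incident by blast
  qed (rule vertices)
qed

lemma color_set_eq_image:
  "color_set H f u = insert (f (Inl u)) ((\<lambda>v. f (Inr {u, v})) ` {v. (u, v) \<in> parcs H})"
  by (auto simp: color_set_def)

lemma out_degree_with_proj: "out_degree (with_proj H) u = card {v. (u, v) \<in> parcs H}"
proof -
  have "out_arcs (with_proj H) u = Pair u ` {v. (u, v) \<in> parcs H}" by (auto simp: out_arcs_def)
  then show ?thesis unfolding out_degree_def by (simp add: card_image inj_on_def)
qed

text \<open>Properness makes the vertex color and the incident edge colors pairwise distinct. The
  count serves both the lower bound and the separation of vertices of different degree.\<close>

lemma card_color_set:
  assumes "pair_graph H" "proper_total_coloring H f"
  shows "card (color_set H f u) = Suc (out_degree (with_proj H) u)"
proof -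
  interpret pair_graph H by (rule assms)
  let ?N = "{v. (u, v) \<in> parcs H}"
  have uedge: "{u, v} \<in> uedges H" if "v \<in> ?N" for v using that unfolding uedges_def by blast
  have "?N \<subseteq> pverts H" using in_arcsD2 by auto
  then have fin: "finite ?N" using pair_finite_verts finite_subset by blast
  have edges: "f (Inr e) \<noteq> f (Inr e')"
    if "e \<in> uedges H" "e' \<in> uedges H" "e \<noteq> e'" "e \<inter> e' \<noteq> {}" for e e'
    using assms(2) that unfolding proper_total_coloring_def by simp
  have incident: "f (Inl u) \<noteq> f (Inr e)" if "e \<in> uedges H" "u \<in> e" for e
    using assms(2) that unfolding proper_total_coloring_def by simp
  have "inj_on (\<lambda>v. f (Inr {u, v})) ?N"
  proof (rule inj_onI, rule ccontr)
    fix v w assume vw: "v \<in> ?N" "w \<in> ?N" "f (Inr {u, v}) = f (Inr {u, w})" "v \<noteq> w"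
    then have "{u, v} \<noteq> {u, w}" by (auto simp: doubleton_eq_iff)
    with vw(3) edges[OF uedge[OF vw(1)] uedge[OF vw(2)]] show False by simp
  qed
  moreover have "f (Inl u) \<notin> (\<lambda>v. f (Inr {u, v})) ` ?N"
    using incident[OF uedge] by force
  ultimately show ?thesis
    using fin unfolding color_set_eq_image out_degree_with_proj by (simp add: card_image)
qed

lemma color_set_subset:
  assumes "u \<in> pverts H"
  shows "color_set H f u \<subseteq> f ` (pverts H <+> uedges H)"
  using assms unfolding color_set_def uedges_def by auto

text \<open>With at most \<open>d + 1\<close> colors, each end of the edge would see all of them,
  and the two color sets would agree.\<close>

lemma avd_total_coloring_lower_bound:
  assumes "pair_graph H" "avd_total_coloring H f" "(u, v) \<in> parcs H"
    and "out_degree (with_proj H) u = d" "out_degree (with_proj H) v = d"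
  shows "d + 2 \<le> card (f ` (pverts H <+> uedges H))"
proof (rule ccontr)
  interpret pair_graph H by (rule assms)
  let ?I = "f ` (pverts H <+> uedges H)"
  assume "\<not> d + 2 \<le> card ?I"
  then have *: "card ?I \<le> Suc d" by simp
  have "finite ?I" using finite_uedges[OF assms(1)] pair_finite_verts by simp
  then have "color_set H f w = ?I" if "w \<in> pverts H" "out_degree (with_proj H) w = d" for w
    using card_seteq color_set_subset[OF that(1)] card_color_set[OF assms(1), of f w] assms(2) * that(2)
    unfolding avd_total_coloring_def by metis
  then have "color_set H f u = color_set H f v"
    using assms(3-5) in_arcsD1 in_arcsD2 by metis
  then show False using assms(2,3) unfolding avd_total_coloring_def by blast
qed

section \<open>Neighbourhoods and degrees in the central graph\<close>

text \<open>For \<open>u \<noteq> v\<close>, the neighbour of \<open>Inl u\<close> met in the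
  direction of \<open>v\<close>. Indexing neighbours by the other vertices of \<open>G\<close>
  treats subdivided and added edges alike and makes the degree \<open>n - 1\<close> evident.\<close>

definition central_nbr :: "'a pair_pre_digraph \<Rightarrow> 'a \<Rightarrow> 'a \<Rightarrow> 'a + 'a set" where
  "central_nbr G u v = (if (u, v) \<in> parcs G then Inr {u, v} else Inl v)"

lemma inj_on_central_nbr: "inj_on (central_nbr G u) A"
  by (auto simp: inj_on_def central_nbr_def doubleton_eq_iff split: if_splits)

lemma central_graph_nbrs_Inl:
  assumes "pair_graph G" "u \<in> pverts G"
  shows "{y. (Inl u, y) \<in> parcs (central_graph G)} = central_nbr G u ` (pverts G - {u})"
proof -
  interpret pair_graph G by (rule assms)
  have symG: "(v, u) \<in> parcs G" if "(u, v) \<in> parcs G" for u v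
    using pair_sym_arcs that by (auto simp: symmetric_def dest: symD)
  have edgeE: "\<exists>v. e = {u, v} \<and> (u, v) \<in> parcs G" if "e \<in> uedges G" "u \<in> e" for e
    using that symG unfolding uedges_def by (auto simp: insert_commute)
  show ?thesis
  proof (intro set_eqI iffI)
    fix y assume "y \<in> {y. (Inl u, y) \<in> parcs (central_graph G)}"
    then consider e where "y = Inr e" "e \<in> uedges G" "u \<in> e"
      | v where "y = Inl v" "v \<in> pverts G" "u \<noteq> v" "(u, v) \<notin> parcs G"
      by (auto simp: central_graph_def)
    then show "y \<in> central_nbr G u ` (pverts G - {u})"
    proof cases
      case 1
      then obtain v where "e = {u, v}" "(u, v) \<in> parcs G" using edgeE by blast
      moreover have "v \<in> pverts G - {u}"
        using in_arcsD2[OF \<open>(u, v) \<in> parcs G\<close>] pair_no_loops[OF \<open>(u, v) \<in> parcs G\<close>] by simp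
      ultimately show ?thesis using 1 by (force simp: central_nbr_def)
    next
      case 2
      then show ?thesis by (force simp: central_nbr_def)
    qed
  next
    fix y assume "y \<in> central_nbr G u ` (pverts G - {u})"
    then show "y \<in> {y. (Inl u, y) \<in> parcs (central_graph G)}"
      using assms(2) by (auto simp: central_nbr_def central_graph_def uedges_def)
  qed
qed

lemma central_graph_nbrs_Inr:
  assumes "e \<in> uedges G"
  shows "{y. (Inr e, y) \<in> parcs (central_graph G)} = Inl ` e"
  using assms by (auto simp: central_graph_def)

lemma out_degree_central_graph_Inl:
  assumes "pair_graph G" "u \<in> pverts G"
  shows "out_degree (with_proj (central_graph G)) (Inl u) = card (pverts G) - 1"
  using assms unfolding out_degree_with_proj central_graph_nbrs_Inl[OF assms]
  by (simp add: card_image inj_on_central_nbr)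

lemma out_degree_central_graph_Inr:
  assumes "e \<in> uedges G"
  shows "out_degree (with_proj (central_graph G)) (Inr e) \<le> 2"
proof -
  obtain a b where "e = {a, b}" using assms by (auto simp: uedges_def)
  then show ?thesis
    using card_insert_le_m1 unfolding out_degree_with_proj central_graph_nbrs_Inr[OF assms]
    by (simp add: card_image card_insert_if)
qed

text \<open>Original vertices have degree \<open>card (pverts G) - 1\<close>, which is at least 2
  and so dominates the subdividing vertices.\<close>

lemma max_degree_central_graph:
  assumes "pair_graph G" "3 \<le> card (pverts G)"
  shows "max_degree (central_graph G) = card (pverts G) - 1"
proof -
  interpret C: pair_graph "central_graph G" by (rule pair_graph_central_graph[OF assms(1)])
  obtain u where u: "u \<in> pverts G" using assms(2) by fastforce
  have "out_degree (with_proj (central_graph G)) y \<le> card (pverts G) - 1"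
    if y: "y \<in> pverts (central_graph G)" for y
  proof -
    consider v where "y = Inl v" "v \<in> pverts G" | e where "y = Inr e" "e \<in> uedges G"
      using y by (auto simp: central_graph_def)
    then show ?thesis
    proof cases
      case 1
      then show ?thesis using out_degree_central_graph_Inl[OF assms(1)] by simp
    next
      case 2
      then show ?thesis using out_degree_central_graph_Inr[of e G] assms(2) by simp
    qed
  qed
  moreover have "card (pverts G) - 1 \<in> out_degree (with_proj (central_graph G)) ` pverts (central_graph G)"
    using out_degree_central_graph_Inl[OF assms(1) u] u
    by (auto simp: central_graph_def image_iff intro!: bexI[of _ "Inl u"])
  ultimately show ?thesis
    unfolding max_degree_def using C.pair_finite_verts by (intro Max_eqI) auto
qed

lemma central_graph_arcE:
  assumes "pair_graph G" "(x, y) \<in> parcs (central_graph G)"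
  obtains (original) u v where "x = Inl u" "u \<in> pverts G" "v \<in> pverts G - {u}"
      "y = central_nbr G u v"
    | (subdivision) u v where "x = Inr {u, v}" "(u, v) \<in> parcs G" "y = Inl u"
proof (cases x)
  case (Inl u)
  interpret C: pair_graph "central_graph G" by (rule pair_graph_central_graph[OF assms(1)])
  have "u \<in> pverts G" using C.in_arcsD1[OF assms(2)] Inl by (auto simp: central_graph_def)
  moreover from this have "y \<in> central_nbr G u ` (pverts G - {u})"
    using central_graph_nbrs_Inl[OF assms(1)] assms(2) Inl by blast
  ultimately show ?thesis using original Inl by blast
next
  case (Inr e)
  interpret pair_graph G by (rule assms)
  obtain u where u: "y = Inl u" "u \<in> e" "e \<in> uedges G"
    using assms(2) Inr by (auto simp: central_graph_def)
  then obtain v where "e = {u, v}" "(u, v) \<in> parcs G"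
    using pair_sym_arcs unfolding uedges_def symmetric_def by (auto simp: insert_commute dest: symD)
  then show ?thesis using subdivision Inr u(1) by blast
qed

section \<open>From a half-edge scheme to a total coloring\<close>

text \<open>Original vertices and all edges take their colors from \<open>k\<close>, so the color
  set of \<open>Inl u\<close> is the row of \<open>u\<close>; the subdividing vertices are colored
  greedily.\<close>

lemma avd_total_coloring_central_graph:
  fixes k :: "'a \<Rightarrow> 'a \<Rightarrow> nat"
  assumes "pair_graph G" "4 \<le> card (pverts G)" "5 \<le> M"
    and bound: "\<And>u v. u \<in> pverts G \<Longrightarrow> v \<in> pverts G \<Longrightarrow> k u v < M"
    and inj: "\<And>u. u \<in> pverts G \<Longrightarrow> inj_on (k u) (pverts G)"
    and adjacent: "\<And>u v. (u, v) \<in> parcs G \<Longrightarrow> k u v \<noteq> k v u"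
    and nonadjacent: "\<And>u v. u \<in> pverts G \<Longrightarrow> v \<in> pverts G \<Longrightarrow> u \<noteq> v \<Longrightarrow> (u, v) \<notin> parcs G \<Longrightarrow>
       k u v = k v u \<and> k u u \<noteq> k v v \<and> k u ` pverts G \<noteq> k v ` pverts G"
  shows "\<exists>f. avd_total_coloring (central_graph G) f \<and>
    f ` (pverts (central_graph G) <+> uedges (central_graph G)) \<subseteq> {..<M}"
proof -
  interpret pair_graph G by (rule assms)
  let ?V = "pverts G" and ?C = "central_graph G"
  interpret C: pair_graph ?C by (rule pair_graph_central_graph[OF assms(1)])
  have pverts_C: "pverts ?C = ?V <+> uedges G" by (simp add: central_graph_def)
  have symG: "(v, u) \<in> parcs G" if "(u, v) \<in> parcs G" for u v
    using pair_sym_arcs that by (auto simp: symmetric_def dest: symD)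
  \<comment> \<open>A subdividing vertex must avoid its two neighbours and its two edges: at most
    four values, while \<open>M \<ge> 5\<close>.\<close>
  have "\<exists>c < M. \<forall>u v. e = {u, v} \<longrightarrow> c \<notin> {k u u, k v v, k u v, k v u}" if "e \<in> uedges G" for e
  proof -
    obtain u v where e: "e = {u, v}" using \<open>e \<in> uedges G\<close> by (auto simp: uedges_def)
    have "card (set [k u u, k v v, k u v, k v u]) \<le> length [k u u, k v v, k u v, k v u]"
      by (rule card_length)
    then have "card {k u u, k v v, k u v, k v u} < card {..<M}" using assms(3) by simp
    then obtain c where "c < M" "c \<notin> {k u u, k v v, k u v, k v u}"
      by (meson card_mono finite.emptyI finite_insert lessThan_iff not_le subsetI)
    then show ?thesis unfolding e by (auto simp: doubleton_eq_iff)
  qed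
  then obtain s where s: "\<And>e. e \<in> uedges G \<Longrightarrow> s e < M"
    "\<And>u v. {u, v} \<in> uedges G \<Longrightarrow> s {u, v} \<notin> {k u u, k v v, k u v, k v u}"
    by metis
  have s_arc: "s {u, v} \<notin> {k u u, k v v, k u v, k v u}" "{u, v} \<in> uedges G"
    if "(u, v) \<in> parcs G" for u v
    using s(2) that by (auto simp: uedges_def)
  \<comment> \<open>An edge between two original vertices arises from both of its ends; the choice
    is well defined because \<open>k\<close> is symmetric on nonadjacent pairs.\<close>
  define edge_color where "edge_color X =
    (SOME c. \<exists>u \<in> ?V. \<exists>v \<in> ?V - {u}. X = {Inl u, central_nbr G u v} \<and> c = k u v)" for X
  have edge_color: "edge_color {Inl u, central_nbr G u v} = k u v"
    if uv: "u \<in> ?V" "v \<in> ?V - {u}" for u v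
    unfolding edge_color_def
  proof (rule some_equality)
    fix c
    assume "\<exists>u' \<in> ?V. \<exists>v' \<in> ?V - {u'}.
      {Inl u, central_nbr G u v} = {Inl u', central_nbr G u' v'} \<and> c = k u' v'"
    then obtain u' v' where *: "u' \<in> ?V" "v' \<in> ?V - {u'}" "c = k u' v'"
      "{Inl u, central_nbr G u v} = {Inl u', central_nbr G u' v'}" by blast
    then have "u = u' \<and> v = v' \<or> u = v' \<and> v = u' \<and> (u, v) \<notin> parcs G"
      by (auto simp: central_nbr_def doubleton_eq_iff split: if_splits)
    then show "c = k u v" using nonadjacent[of u v] uv *(3) by auto
  qed (use uv in blast)
  \<comment> \<open>The outer sum separates vertices from edges of the central graph, the inner one
    original from subdividing vertices.\<close>
  define f where "f = case_sum (case_sum (\<lambda>u. k u u) s) edge_color"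
  have f_simps: "f (Inl (Inl u)) = k u u" "f (Inl (Inr e)) = s e" "f (Inr X) = edge_color X"
    for u e X by (simp_all add: f_def)
  have sub_edge: "edge_color {Inr {u, v}, Inl u} = k u v" if "(u, v) \<in> parcs G" for u v
  proof -
    have "u \<in> ?V" "v \<in> ?V - {u}"
      using in_arcsD1[OF that] in_arcsD2[OF that] pair_no_loops[OF that] by auto
    from edge_color[OF this] that show ?thesis by (simp add: central_nbr_def insert_commute)
  qed
  have proper: "proper_total_coloring ?C f"
  proof (rule proper_total_coloringI[OF C.pair_graph_axioms])
    fix x y assume "(x, y) \<in> parcs ?C"
    with assms(1) show "f (Inl x) \<noteq> f (Inl y)"
    proof (cases rule: central_graph_arcE)
      case (original u v)
      then show ?thesis
        using nonadjacent[of u v] s_arc[of u v] by (auto simp: f_simps central_nbr_def)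
    next
      case (subdivision u v)
      then show ?thesis using s_arc[of u v] by (auto simp: f_simps)
    qed
  next
    fix x y assume "(x, y) \<in> parcs ?C"
    with assms(1) show "f (Inl x) \<noteq> f (Inr {x, y})"
    proof (cases rule: central_graph_arcE)
      case (original u v)
      then show ?thesis using inj_onD[OF inj, of u u v] by (auto simp: f_simps edge_color)
    next
      case (subdivision u v)
      then show ?thesis using s_arc[of u v] sub_edge[of u v] by (auto simp: f_simps)
    qed
  next
    fix x
    show "inj_on (\<lambda>y. f (Inr {x, y})) {y. (x, y) \<in> parcs ?C}"
    proof (rule inj_onI, clarify)
      fix y z
      assume y: "(x, y) \<in> parcs ?C" and z: "(x, z) \<in> parcs ?C" and eq: "f (Inr {x, y}) = f (Inr {x, z})"
      from assms(1) y show "y = z"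
      proof (cases rule: central_graph_arcE)
        case (original u v)
        from assms(1) z obtain w where "w \<in> ?V - {u}" "z = central_nbr G u w"
          by (cases rule: central_graph_arcE) (use original in auto)
        then show ?thesis
          using original eq inj_onD[OF inj, of u v w] by (auto simp: f_simps edge_color)
      next
        case (subdivision u v)
        from assms(1) z consider "z = Inl u" | "z = Inl v"
          by (cases rule: central_graph_arcE) (use subdivision in \<open>auto simp: doubleton_eq_iff\<close>)
        then show ?thesis
          using subdivision eq adjacent[of u v] sub_edge[of u v] sub_edge[of v u] symG[of u v]
          by cases (auto simp: f_simps insert_commute)
      qed
    qed
  qed
  have color_set_Inl: "color_set ?C f (Inl u) = k u ` ?V" if "u \<in> ?V" for u
  proof -
    have "color_set ?C f (Inl u) = insert (k u u) (k u ` (?V - {u}))"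
      unfolding color_set_eq_image central_graph_nbrs_Inl[OF assms(1) that] image_image
      using edge_color that by (simp add: f_simps)
    then show ?thesis using that by blast
  qed
  \<comment> \<open>Sizes suffice here: a row has at least four colors, a subdividing vertex sees at
    most three.\<close>
  have card_ne: "color_set ?C f (Inl u) \<noteq> color_set ?C f (Inr e)"
    if "u \<in> ?V" "e \<in> uedges G" for u e
  proof -
    have "card (color_set ?C f (Inl u)) \<ge> 4"
      using card_image[OF inj] color_set_Inl that(1) assms(2) by simp
    moreover have "card (color_set ?C f (Inr e)) \<le> 3"
      using card_color_set[OF C.pair_graph_axioms proper] out_degree_central_graph_Inr[OF that(2)]
      by simp
    ultimately show ?thesis by force
  qed
  have "avd_total_coloring ?C f"
    unfolding avd_total_coloring_def
  proof (intro conjI allI impI proper)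
    fix x y assume "(x, y) \<in> parcs ?C"
    with assms(1) show "color_set ?C f x \<noteq> color_set ?C f y"
    proof (cases rule: central_graph_arcE)
      case (original u v)
      then show ?thesis
        using nonadjacent[of u v] s_arc(2)[of u v] card_ne[of u "{u, v}"] color_set_Inl
        by (auto simp: central_nbr_def split: if_splits)
    next
      case (subdivision u v)
      then show ?thesis using card_ne[of u "{u, v}"] s_arc(2) in_arcsD1 by auto
    qed
  qed
  moreover have "f z < M" if z: "z \<in> pverts ?C <+> uedges ?C" for z
  proof -
    consider u where "z = Inl (Inl u)" "u \<in> ?V" | e where "z = Inl (Inr e)" "e \<in> uedges G"
      | x y where "z = Inr {x, y}" "(x, y) \<in> parcs ?C"
      using z by (auto simp: pverts_C uedges_def[of ?C])
    then show ?thesis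
    proof cases
      case 3
      from assms(1) 3(2) show ?thesis
        by (cases rule: central_graph_arcE)
          (use 3 bound edge_color sub_edge in_arcsD1 in_arcsD2 in \<open>auto simp: f_simps\<close>)
    qed (use bound s(1) in \<open>auto simp: f_simps\<close>)
  qed
  ultimately show ?thesis by blast
qed

section \<open>Bounds on the chromatic number of the central graph\<close>

lemma avd_total_chromatic_number_central_graph_le:
  assumes "pair_graph G" "Digraph_Component.connected (with_proj G)"
    and "4 \<le> card (pverts G)" "odd M" "card (pverts G) < M"
  shows "avd_total_chromatic_number (central_graph G) \<le> M"
proof -
  obtain f where f: "avd_total_coloring (central_graph G) f"
      "f ` (pverts (central_graph G) <+> uedges (central_graph G)) \<subseteq> {..<M}"
  proof (rule ex_half_edge_scheme[OF assms(1,2,4,5)])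
    fix k :: "'a \<Rightarrow> 'a \<Rightarrow> nat"
    assume "\<And>u v. u \<in> pverts G \<Longrightarrow> v \<in> pverts G \<Longrightarrow> k u v < M"
      "\<And>u. u \<in> pverts G \<Longrightarrow> inj_on (k u) (pverts G)"
      "\<And>u v. (u, v) \<in> parcs G \<Longrightarrow> k u v \<noteq> k v u"
      "\<And>u v. u \<in> pverts G \<Longrightarrow> v \<in> pverts G \<Longrightarrow> u \<noteq> v \<Longrightarrow> (u, v) \<notin> parcs G \<Longrightarrow>
         k u v = k v u \<and> k u u \<noteq> k v v \<and> k u ` pverts G \<noteq> k v ` pverts G"
    from avd_total_coloring_central_graph[OF assms(1,3) _ this] assms(3,5) that
    show thesis by auto
  qed
  let ?I = "f ` (pverts (central_graph G) <+> uedges (central_graph G))"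
  have "avd_total_chromatic_number (central_graph G) \<le> card ?I"
    unfolding avd_total_chromatic_number_def using f(1) by (intro Least_le) blast
  also have "\<dots> \<le> card {..<M}" using f(2) by (intro card_mono) auto
  finally show ?thesis by simp
qed

text \<open>The vertices \<open>u\<close> and \<open>v\<close> become adjacent in the central graph
  and both have degree \<open>card (pverts G) - 1\<close> there.\<close>

lemma avd_total_chromatic_number_central_graph_ge:
  assumes "pair_graph G" "u \<in> pverts G" "v \<in> pverts G" "u \<noteq> v" "(u, v) \<notin> parcs G"
  shows "card (pverts G) + 1 \<le> avd_total_chromatic_number (central_graph G)"
proof -
  let ?C = "central_graph G"
  have C: "pair_graph ?C" by (rule pair_graph_central_graph[OF assms(1)])
  interpret pair_graph G by (rule assms)
  have "\<exists>k f. avd_total_coloring ?C f \<and> card (f ` (pverts ?C <+> uedges ?C)) = k"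
    using avd_total_coloring_exists[OF C] by simp
  from LeastI_ex[OF this, folded avd_total_chromatic_number_def] obtain f where f: "avd_total_coloring ?C f"
      "card (f ` (pverts ?C <+> uedges ?C)) = avd_total_chromatic_number ?C" by blast
  have "(Inl u, Inl v) \<in> parcs ?C" using assms by (simp add: central_graph_def)
  from avd_total_coloring_lower_bound[OF C f(1) this]
  have "card (pverts G) - 1 + 2 \<le> avd_total_chromatic_number ?C"
    using out_degree_central_graph_Inl[OF assms(1)] assms(2,3) f(2) by simp
  moreover have "card (pverts G) \<noteq> 0" using assms(2) pair_finite_verts by auto
  ultimately show ?thesis by simp
qed

theorem theorem4p9:
  fixes G :: "'a pair_pre_digraph" and n :: nat
  assumes "pair_graph G"
    and "Digraph_Component.connected (with_proj G)"
    and "regular_graph G"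
    and "card (pverts G) = n"
    and "n \<ge> 5"
  shows "(even n \<and> \<not> K\<^bsub>n\<^esub> (with_proj G) \<longrightarrow> avd_type 2 (central_graph G)) \<and>
         (odd n \<longrightarrow> satisfies_avd_tcc (central_graph G))"
proof (intro conjI impI)
  interpret pair_graph G by (rule assms)
  let ?\<chi> = "avd_total_chromatic_number (central_graph G)"
  have deg: "max_degree (central_graph G) = n - 1"
    using max_degree_central_graph[OF assms(1)] assms(4,5) by simp
  have upper: "?\<chi> \<le> M" if "odd M" "n < M" for M
    using avd_total_chromatic_number_central_graph_le[OF assms(1,2)] that assms(4,5) by simp
  {
    assume n: "even n \<and> \<not> K\<^bsub>n\<^esub> (with_proj G)"
    have "parcs G \<subseteq> {(u, v). (u, v) \<in> pverts G \<times> pverts G \<and> u \<noteq> v}"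
      using in_arcsD1 in_arcsD2 pair_no_loops by fastforce
    then obtain u v where "u \<in> pverts G" "v \<in> pverts G" "u \<noteq> v" "(u, v) \<notin> parcs G"
      using n assms(4) pair_finite_verts unfolding complete_digraph_pair_def by blast
    then have "n + 1 \<le> ?\<chi>"
      using avd_total_chromatic_number_central_graph_ge[OF assms(1)] assms(4) by blast
    \<comment> \<open>For even \<open>n\<close> the least odd \<open>M\<close> above
      \<open>n\<close> is \<open>n + 1\<close>, the maximum degree plus 2.\<close>
    moreover have "?\<chi> \<le> n + 1" using upper[of "n + 1"] n by simp
    ultimately show "avd_type 2 (central_graph G)"
      unfolding avd_type_def deg using assms(5) by simp
  next
    assume "odd n"
    \<comment> \<open>For odd \<open>n\<close> the least odd \<open>M\<close> above \<open>n\<close>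
      is \<open>n + 2\<close>, the maximum degree plus 3.\<close>
    then have "?\<chi> \<le> n + 2" using upper[of "n + 2"] by simp
    then show "satisfies_avd_tcc (central_graph G)"
      unfolding satisfies_avd_tcc_def deg using assms(5) by simp
  }
qed

end
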